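(* Let $\mu$ be an $n$-dimensional Radon measure on $\mathbb{R}^d$ ($n\in\mathbb{R}$, $0<n\le d$), let $0<\alpha\le 1$, and let $1\le p\le\infty$ be given. For a function $f\in L^1_{\mathrm{loc}}(\mu)$, the conditions (I), (II) and (III) below are equivalent. (I) There exist a constant $C_1$ and a collection of numbers $f_B$, one for each ball $B$, such that these two properties hold: for any ball $B$ with radius $r$, $$\frac{1}{\mu(2B)}\int_B |f(x)-f_B|\,d\mu(x)\le C_1 r^\alpha,$$ and, for any ball $B$ with radius $r$ and any ball $U$ such that $B\subset U$ and $\mathrm{radius}(U)\le 2r$, $$|f_B-f_U|\le C_1 r^\alpha .$$ (II) There is a constant $C_2$ such that $$|f(x)-f(y)|\le C_2|x-y|^\alpha$$ for $\mu$-almost every $x$ and $y$ in the support of $\mu$. (III) There is a constant $C(p)$ such that for every ball $B$ of radius $r$, $$\left(\frac{1}{\mu(B)}\int_B |f(x)-m_B(f)|^p\,d\mu(x)\right)^{1/p}\le C(p)\,r^\alpha,$$ where $m_B(f)=\frac{1}{\mu(B)}\int_B f(y)\,d\mu(y)$, and also, for any ball $U$ such that $B\subset U$ and $\mathrm{radius}(U)\le 2r$, $$|m_B(f)-m_U(f)|\le C(p)\,r^\alpha .$$ In addition, the quantities $\inf C_1$, $\inf C_2$ and $\inf C(p)$ (for the fixed $p$) are equivalent, i.e. each is bounded by a constant independent of $f$ times any other; here the infima are taken over all constants admissible in (I) (over all choices of the collection $\{f_B\}$), (II) and (III) respectively.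
   Context: A Radon measure $\mu$ on $\mathbb{R}^d$ is called $n$-dimensional if there is a constant $C$ such that $\mu(B(x,r))\le C r^n$ for every ball $B(x,r)$ with center $x\in\mathbb{R}^d$ and radius $r>0$; $\mu$ need not be doubling. All balls considered in conditions (I) and (III) (both $B$ and $U$) are Euclidean balls of positive radius centered at points of the support of $\mu$. For a ball $B=B(x,r)$, $2B=B(x,2r)$. The statement "for $\mu$-almost every $x$ and $y$" in (II) means that there is a $\mu$-null set outside of which the inequality holds for all pairs $x,y$ in the support of $\mu$. For $p=\infty$ the $L^p$-average over $B$ is interpreted as the $\mu$-essential supremum over $B$. *)

theory Defs
  imports "HOL-Analysis.Analysis" "HOL-Probability.Essential_Supremum"
begin

definition radon_measure :: "'a::euclidean_space measure \<Rightarrow> bool" where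
  "radon_measure \<mu> \<longleftrightarrow>
     sets \<mu> = sets borel \<and>
     (\<forall>K. compact K \<longrightarrow> emeasure \<mu> K < \<infinity>) \<and>
     (\<forall>A\<in>sets borel. emeasure \<mu> A = (SUP K\<in>{K. compact K \<and> K \<subseteq> A}. emeasure \<mu> K))"

definition n_dimensional :: "real \<Rightarrow> 'a::euclidean_space measure \<Rightarrow> bool" where
  "n_dimensional n \<mu> \<longleftrightarrow>
     (\<exists>C::real. \<forall>x r. 0 < r \<longrightarrow> emeasure \<mu> (ball x r) \<le> ennreal (C * r powr n))"

definition msupport :: "'a::euclidean_space measure \<Rightarrow> 'a set" where
  "msupport \<mu> = {x. \<forall>r>0. emeasure \<mu> (ball x r) > 0}"

text \<open>
  The scalar type below is any normed field of sort \<open>{real_normed_field, euclidean_space}\<close>,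
  so that the real-valued and the complex-valued case are both covered.
\<close>

definition L1_loc ::
    "'a::euclidean_space measure \<Rightarrow> ('a \<Rightarrow> 'k::{real_normed_field, euclidean_space}) set" where
  "L1_loc \<mu> = {f \<in> borel_measurable \<mu>. \<forall>K. compact K \<longrightarrow> set_integrable \<mu> K f}"

definition mean ::
    "'a::euclidean_space measure \<Rightarrow> ('a \<Rightarrow> 'k::{real_normed_field, euclidean_space}) \<Rightarrow> 'a set \<Rightarrow> 'k" where
  "mean \<mu> f B = (1 / measure \<mu> B) *\<^sub>R (LINT y:B|\<mu>. f y)"

text \<open>
  The average over a set \<open>B\<close> of finite positive measure of the \<open>p\<close>-th power of \<open>|g|\<close>, to the
  power \<open>1/p\<close>. It takes values in \<^typ>\<open>ennreal\<close> because a locally integrable function need not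
  be locally \<open>p\<close>-integrable, in which case the average has to be infinite (whereas the Bochner
  integral would be \<open>0\<close>).
\<close>

definition Lp_average ::
    "ennreal \<Rightarrow> 'a::euclidean_space measure \<Rightarrow> 'a set
      \<Rightarrow> ('a \<Rightarrow> 'k::{real_normed_field, euclidean_space}) \<Rightarrow> ennreal" where
  "Lp_average p \<mu> B g =
     (if p = \<infinity> then esssup (restrict_space \<mu> B) (\<lambda>x. ennreal (norm (g x)))
      else let A = (\<integral>\<^sup>+x\<in>B. ennreal (norm (g x) powr enn2real p) \<partial>\<mu>) / emeasure \<mu> B
           in if A = \<infinity> then \<infinity> else ennreal (enn2real A powr (1 / enn2real p)))"

text \<open>
  \<open>admissible_I\<close>, \<open>admissible_II\<close> and \<open>admissible_III\<close> say that the constant \<open>C\<close> can be taken in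
  condition (I), (II) and (III) respectively. Nonnegativity of \<open>C\<close> is automatic unless the support
  is empty, that is, \<open>\<mu> = 0\<close>. A collection of numbers indexed by balls is a function \<open>F\<close> of centre
  and radius, which are determined by the ball.
\<close>

definition admissible_I ::
    "'a::euclidean_space measure \<Rightarrow> real \<Rightarrow> ('a \<Rightarrow> 'k::{real_normed_field, euclidean_space})
      \<Rightarrow> real \<Rightarrow> bool" where
  "admissible_I \<mu> \<alpha> f C \<longleftrightarrow> 0 \<le> C \<and>
     (\<exists>F :: 'a \<Rightarrow> real \<Rightarrow> 'k.
        (\<forall>x\<in>msupport \<mu>. \<forall>r>0.
           1 / measure \<mu> (ball x (2 * r)) * (LINT z:ball x r|\<mu>. norm (f z - F x r))
             \<le> C * r powr \<alpha>) \<and>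
        (\<forall>x\<in>msupport \<mu>. \<forall>r>0. \<forall>y\<in>msupport \<mu>. \<forall>s>0.
           ball x r \<subseteq> ball y s \<and> s \<le> 2 * r \<longrightarrow> norm (F x r - F y s) \<le> C * r powr \<alpha>))"

definition admissible_II ::
    "'a::euclidean_space measure \<Rightarrow> real \<Rightarrow> ('a \<Rightarrow> 'k::{real_normed_field, euclidean_space})
      \<Rightarrow> real \<Rightarrow> bool" where
  "admissible_II \<mu> \<alpha> f C \<longleftrightarrow> 0 \<le> C \<and>
     (\<exists>N\<in>null_sets \<mu>. \<forall>x\<in>msupport \<mu> - N. \<forall>y\<in>msupport \<mu> - N.
        norm (f x - f y) \<le> C * dist x y powr \<alpha>)"

definition admissible_III ::
    "ennreal \<Rightarrow> 'a::euclidean_space measure \<Rightarrow> real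
      \<Rightarrow> ('a \<Rightarrow> 'k::{real_normed_field, euclidean_space}) \<Rightarrow> real \<Rightarrow> bool" where
  "admissible_III p \<mu> \<alpha> f C \<longleftrightarrow> 0 \<le> C \<and>
     (\<forall>x\<in>msupport \<mu>. \<forall>r>0.
        Lp_average p \<mu> (ball x r) (\<lambda>z. f z - mean \<mu> f (ball x r)) \<le> ennreal (C * r powr \<alpha>)) \<and>
     (\<forall>x\<in>msupport \<mu>. \<forall>r>0. \<forall>y\<in>msupport \<mu>. \<forall>s>0.
        ball x r \<subseteq> ball y s \<and> s \<le> 2 * r \<longrightarrow>
          norm (mean \<mu> f (ball x r) - mean \<mu> f (ball y s)) \<le> C * r powr \<alpha>)"

text \<open>The infimum is \<open>\<infinity>\<close> if there is no admissible constant.\<close>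

definition inf_const :: "(real \<Rightarrow> bool) \<Rightarrow> ereal" where
  "inf_const P = (INF C\<in>{C. P C}. ereal C)"

end

theory Submission
  imports Defs
begin

text \<open>
  Condition (III) gives (I) with \<open>f\<^sub>B = m\<^sub>B(f)\<close> by Jensen's inequality, and (II) gives (III)
  because every mean over a ball lies within \<open>C (2 r)\<^sup>\<alpha>\<close> of almost every value of \<open>f\<close> there.

  For (I) \<open>\<Longrightarrow>\<close> (II), comparing consecutive dyadic balls shows that \<open>f\<^sub>B\<close> for \<open>B = B(x,r)\<close> converges as
  \<open>r \<rightarrow> 0\<close>, at rate \<open>r\<^sup>\<alpha>\<close>, to some \<open>g(x)\<close>, and that \<open>g\<close> is Hoelder continuous on the support. It
  remains to see that \<open>f = g\<close> almost everywhere. Since \<open>\<mu>\<close> need not be doubling, this is done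
  without differentiation of integrals: the integral of \<open>|f - g|\<close> over \<open>B(x,r)\<close> is at most
  \<open>D r\<^sup>\<alpha> \<mu>(B(x,5r))\<close> for every centre \<open>x\<close>, and integrating this over \<open>x\<close> in Lebesgue measure
  bounds the integral of \<open>|f - g|\<close> over any fixed ball by a constant times \<open>r\<^sup>\<alpha>\<close>.
\<close>

section \<open>Dyadic chains of scales\<close>

lemma dyadic_chain_bound:
  fixes F :: "real \<Rightarrow> 'b::real_normed_vector"
  assumes \<alpha>: "0 < \<alpha>" "\<alpha> \<le> 1" and C: "0 \<le> C"
    and step: "\<And>r s. 0 < r \<Longrightarrow> r \<le> s \<Longrightarrow> s \<le> 2 * r \<Longrightarrow> norm (F r - F s) \<le> C * r powr \<alpha>"
    and rs: "0 < s" "s \<le> r"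
  shows "norm (F s - F r) \<le> C / (2 powr \<alpha> - 1) * r powr \<alpha>"
proof -
  define A where "A = C / (2 powr \<alpha> - 1)"
  have two: "1 < 2 powr \<alpha>" "2 powr \<alpha> \<le> 2"
    using \<alpha> powr_mono[of \<alpha> 1 2] by auto
  \<comment> \<open>The second bound uses 2^\<alpha> - 1 \<le> 1, hence \<alpha> \<le> 1. It pays
    for the last link, from \<open>r \<le> 2 * s\<close> straight to \<open>s\<close>.\<close>
  have "0 \<le> A" "C \<le> A"
    using two C by (auto simp: A_def le_divide_eq intro!: mult_left_le)
  \<comment> \<open>The induction closes without loss: the bound with \<open>A\<close> at scale
    \<open>r / 2\<close> plus one link with \<open>C\<close> is exactly the bound with
    \<open>A\<close> at scale \<open>r\<close>.\<close>
  have AC: "A + C = A * 2 powr \<alpha>"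
  proof -
    have "A * (2 powr \<alpha> - 1) = C"
      using two \<alpha> by (simp add: A_def)
    then show ?thesis
      by (simp add: algebra_simps)
  qed
  have "norm (F s - F r) \<le> A * r powr \<alpha>" if "s \<le> r" "r \<le> 2 ^ k * s" for k r
    using that
  proof (induction k arbitrary: r)
    case 0
    with \<open>0 \<le> A\<close> show ?case by simp
  next
    case (Suc k)
    show ?case
    proof (cases "r \<le> 2 * s")
      case True
      then have "norm (F s - F r) \<le> C * s powr \<alpha>"
        using step Suc rs by simp
      also have "\<dots> \<le> A * r powr \<alpha>"
        using Suc rs \<alpha> \<open>C \<le> A\<close> C by (intro mult_mono powr_mono2) auto
      finally show ?thesis .
    next
      case False
      have "norm (F s - F (r / 2)) \<le> A * (r / 2) powr \<alpha>"
        using False Suc by (intro Suc.IH) auto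
      moreover have "norm (F (r / 2) - F r) \<le> C * (r / 2) powr \<alpha>"
        using Suc rs by (intro step) auto
      ultimately have "norm (F s - F r) \<le> (A + C) * (r / 2) powr \<alpha>"
        using norm_triangle_le[of "F s - F (r / 2)" "F (r / 2) - F r"]
        by (simp add: algebra_simps)
      also have "\<dots> = A * r powr \<alpha>"
        using AC Suc rs by (simp add: powr_divide)
      finally show ?thesis .
    qed
  qed
  moreover obtain k where "r / s < 2 ^ k"
    using real_arch_pow[of 2] by auto
  then have "r \<le> 2 ^ k * s"
    using rs by (simp add: field_simps)
  ultimately show ?thesis
    using rs by (simp add: A_def)
qed

text \<open>The radii 2^-j only serve as a reference sequence. They eventually fall below any given
  \<open>r\<close>, so the chain bound compares \<open>F r\<close> with the tail of the sequence and
  survives the passage to the limit.\<close>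

lemma dyadic_chain_limit:
  fixes F :: "real \<Rightarrow> 'b::banach"
  assumes \<alpha>: "0 < \<alpha>" "\<alpha> \<le> 1" and C: "0 \<le> C"
    and step: "\<And>r s. 0 < r \<Longrightarrow> r \<le> s \<Longrightarrow> s \<le> 2 * r \<Longrightarrow> norm (F r - F s) \<le> C * r powr \<alpha>"
  shows "\<exists>g. \<forall>r>0. norm (F r - g) \<le> C / (2 powr \<alpha> - 1) * r powr \<alpha>"
proof -
  define A where "A = C / (2 powr \<alpha> - 1)"
  define X where "X = (\<lambda>j::nat. F ((1 / 2) ^ j))"
  have bound: "norm (F s - F r) \<le> A * r powr \<alpha>" if "0 < s" "s \<le> r" for r s
    unfolding A_def by (rule dyadic_chain_bound) (use assms that in auto)
  have lim: "(\<lambda>j::nat. (1 / 2 :: real) ^ j) \<longlonglongrightarrow> 0"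
    by (rule LIMSEQ_realpow_zero) auto
  have "Cauchy X"
  proof (rule CauchyI)
    fix e :: real assume "0 < e"
    have "(\<lambda>j::nat. 2 * (A * ((1 / 2) ^ j) powr \<alpha>)) \<longlonglongrightarrow> 2 * (A * 0 powr \<alpha>)"
      using \<alpha> by (intro tendsto_intros tendsto_powr' lim) auto
    then have "\<forall>\<^sub>F j in sequentially. 2 * (A * ((1 / 2) ^ j) powr \<alpha>) < e"
      using \<open>0 < e\<close> by (intro order_tendstoD(2)) auto
    then obtain M where M: "2 * (A * ((1 / 2) ^ M) powr \<alpha>) < e"
      by (auto simp: eventually_sequentially)
    have XM: "norm (X m - X M) \<le> A * ((1 / 2) ^ M) powr \<alpha>" if "M \<le> m" for m
      unfolding X_def using that by (intro bound power_decreasing) auto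
    show "\<exists>M. \<forall>m\<ge>M. \<forall>n\<ge>M. norm (X m - X n) < e"
    proof (intro exI[of _ M] allI impI)
      fix m n assume "M \<le> m" "M \<le> n"
      then show "norm (X m - X n) < e"
        using XM[of m] XM[of n] M norm_triangle_ineq4[of "X m - X M" "X n - X M"] by simp
    qed
  qed
  then obtain g where g: "X \<longlonglongrightarrow> g"
    using Cauchy_convergent convergent_def by blast
  have "norm (F r - g) \<le> A * r powr \<alpha>" if r: "0 < r" for r
  proof (rule tendsto_upperbound)
    show "(\<lambda>j. norm (F r - X j)) \<longlonglongrightarrow> norm (F r - g)"
      by (intro tendsto_intros g)
    have "\<forall>\<^sub>F j in sequentially. (1 / 2) ^ j < r"
      using lim r by (rule order_tendstoD)
    then show "\<forall>\<^sub>F j in sequentially. norm (F r - X j) \<le> A * r powr \<alpha>"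
    proof eventually_elim
      case (elim j)
      then show ?case
        using bound[of "(1 / 2) ^ j" r] by (simp add: X_def norm_minus_commute)
    qed
  qed auto
  then show ?thesis
    by (auto simp: A_def)
qed

section \<open>Averages of order p and Jensen's inequality\<close>

text \<open>
  The tangent line at \<open>t = c\<close> of the convex function \<open>t\<^sup>P\<close>, rearranged so that integrating it
  gives Jensen's inequality without any subtraction in \<^typ>\<open>ennreal\<close>.
\<close>
lemma young_scaled:
  fixes t c P :: real
  assumes "1 \<le> P" "0 < c" "0 \<le> t"
  shows "t \<le> c powr (1 - P) / P * t powr P + c * (1 - 1 / P)"
proof (cases "t = 0")
  case False
  then have "(t / c) \<le> (1 / P) * (t / c) powr P + (1 - 1 / P) * 1"
    using Youngs_inequality_0[of "1 / P" "1 - 1 / P" "(t / c) powr P" 1] assms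
    by (simp add: powr_powr)
  then have "c * (t / c) \<le> c * ((1 / P) * (t / c) powr P + (1 - 1 / P) * 1)"
    using assms by (intro mult_left_mono) auto
  also have "c * ((1 / P) * (t / c) powr P + (1 - 1 / P) * 1) =
      c powr (1 - P) / P * t powr P + c * (1 - 1 / P)"
    using assms by (simp add: powr_divide powr_diff algebra_simps)
  finally show ?thesis
    using assms by simp
qed (use assms in auto)

lemma Lp_average_leI:
  assumes B: "B \<in> sets \<mu>" "emeasure \<mu> B = ennreal m" "0 < m"
    and g [measurable]: "g \<in> borel_measurable \<mu>" and p: "1 \<le> p" and c: "0 \<le> c"
    and le: "AE z in \<mu>. z \<in> B \<longrightarrow> norm (g z) \<le> c"
  shows "Lp_average p \<mu> B g \<le> ennreal c"
proof (cases "p = \<infinity>")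
  case True
  have "esssup (restrict_space \<mu> B) (\<lambda>x. ennreal (norm (g x))) \<le> ennreal c"
  proof (rule esssup_I)
    show "(\<lambda>x. ennreal (norm (g x))) \<in> borel_measurable (restrict_space \<mu> B)"
      by (intro measurable_restrict_space1) measurable
    show "AE x in restrict_space \<mu> B. ennreal (norm (g x)) \<le> ennreal c"
      using B le by (subst AE_restrict_space_iff) (auto simp: ennreal_le_iff[OF c])
  qed
  with True show ?thesis
    by (simp add: Lp_average_def)
next
  case False
  define P where "P = enn2real p"
  have P: "1 \<le> P"
    using p False enn2real_mono[of 1 p] by (simp add: P_def less_top)
  define A where "A = (\<integral>\<^sup>+x\<in>B. ennreal (norm (g x) powr P) \<partial>\<mu>) / emeasure \<mu> B"
  have "(\<integral>\<^sup>+x\<in>B. ennreal (norm (g x) powr P) \<partial>\<mu>) \<le> (\<integral>\<^sup>+x. ennreal (c powr P) * indicator B x \<partial>\<mu>)"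
    using le by (intro nn_integral_mono_AE, eventually_elim)
      (use P in \<open>auto simp: indicator_def intro!: ennreal_leI powr_mono2\<close>)
  also have "\<dots> = ennreal (c powr P * m)"
    using B by (simp add: nn_integral_cmult_indicator ennreal_mult)
  finally have "A \<le> ennreal (c powr P * m) / ennreal m"
    unfolding A_def B by (rule divide_right_mono_ennreal)
  also have "\<dots> = ennreal (c powr P)"
    using B by (simp add: divide_ennreal)
  finally have A: "A \<le> ennreal (c powr P)" .
  \<comment> \<open>This selects the finite branch of \<open>Lp_average\<close>.\<close>
  then have "A \<noteq> \<infinity>"
    by (metis ennreal_less_top infinity_ennreal_def leD)
  have "enn2real A \<le> c powr P"
    using A by (simp add: enn2real_leI)
  then have "enn2real A powr (1 / P) \<le> (c powr P) powr (1 / P)"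
    using P by (intro powr_mono2) auto
  also have "\<dots> = c"
    using P c by (simp add: powr_powr)
  finally show ?thesis
    using False \<open>A \<noteq> \<infinity>\<close> by (simp add: Lp_average_def A_def P_def Let_def ennreal_leI)
qed

text \<open>This is Jensen's inequality from exponent p down to 1, including p = \<infinity>. For
  finite p the inequality \<open>young_scaled\<close> is integrated over \<open>B\<close>.\<close>

lemma Lp_average_leD:
  assumes B [measurable]: "B \<in> sets \<mu>" and m: "emeasure \<mu> B = ennreal m" "0 < m"
    and g [measurable]: "g \<in> borel_measurable \<mu>" and p: "1 \<le> p" and c: "0 \<le> c"
    and le: "Lp_average p \<mu> B g \<le> ennreal c"
  shows "(\<integral>\<^sup>+z\<in>B. ennreal (norm (g z)) \<partial>\<mu>) \<le> ennreal (c * m)"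
proof (cases "p = \<infinity>")
  case True
  have "AE x in restrict_space \<mu> B. ennreal (norm (g x)) \<le> ennreal c"
    using esssup_AE[of "\<lambda>x. ennreal (norm (g x))" "restrict_space \<mu> B"]
    by eventually_elim (use le True in \<open>auto simp: Lp_average_def intro: order_trans\<close>)
  then have "AE z in \<mu>. z \<in> B \<longrightarrow> ennreal (norm (g z)) \<le> ennreal c"
    by (subst (asm) AE_restrict_space_iff) auto
  then have "(\<integral>\<^sup>+z\<in>B. ennreal (norm (g z)) \<partial>\<mu>) \<le> (\<integral>\<^sup>+z. ennreal c * indicator B z \<partial>\<mu>)"
    by (intro nn_integral_mono_AE, eventually_elim) (auto simp: indicator_def)
  also have "\<dots> = ennreal (c * m)"
    using c m by (simp add: nn_integral_cmult_indicator ennreal_mult)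
  finally show ?thesis .
next
  case False
  define P where "P = enn2real p"
  have P: "1 \<le> P"
    using p False enn2real_mono[of 1 p] by (simp add: P_def less_top)
  define I where "I = (\<integral>\<^sup>+x\<in>B. ennreal (norm (g x) powr P) \<partial>\<mu>)"
  define A where "A = I / emeasure \<mu> B"
  have A: "A \<noteq> \<infinity>" "ennreal (enn2real A powr (1 / P)) \<le> ennreal c"
    using le False by (auto simp: Lp_average_def A_def I_def P_def Let_def top_unique split: if_splits)
  then have "enn2real A powr (1 / P) \<le> c"
    using c by simp
  then have "(enn2real A powr (1 / P)) powr P \<le> c powr P"
    using P by (intro powr_mono2) auto
  then have "enn2real A \<le> c powr P"
    using P by (simp add: powr_powr)
  then have "A \<le> ennreal (c powr P)"
    using A by (metis ennreal_enn2real ennreal_leI infinity_ennreal_def less_top)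
  then have "A * ennreal m \<le> ennreal (c powr P) * ennreal m"
    by (rule mult_right_mono) simp
  moreover have "A * ennreal m = I"
    using m by (simp add: A_def ennreal_divide_times mult_divide_eq_ennreal)
  ultimately have I: "I \<le> ennreal (c powr P * m)"
    using m by (simp add: ennreal_mult)
  show ?thesis
  \<comment> \<open>\<open>young_scaled\<close> needs \<open>0 < c\<close>. If \<open>c = 0\<close>,
    the integral of the P-th power vanishes, so \<open>g\<close> is 0 almost everywhere on
    \<open>B\<close>.\<close>
  proof (cases "c = 0")
    case True
    with I have "I = 0" by simp
    then have "AE x in \<mu>. ennreal (norm (g x) powr P) * indicator B x = 0"
      unfolding I_def by (subst (asm) nn_integral_0_iff_AE) auto
    then have "AE x in \<mu>. ennreal (norm (g x)) * indicator B x = 0"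
      by eventually_elim (auto simp: indicator_def split: if_splits)
    then have "(\<integral>\<^sup>+z\<in>B. ennreal (norm (g z)) \<partial>\<mu>) = 0"
      by (subst nn_integral_0_iff_AE) auto
    then show ?thesis by simp
  next
    case False
    with c have c: "0 < c" by simp
    let ?k = "c powr (1 - P) / P"
    have "ennreal (norm (g z)) \<le> ennreal ?k * ennreal (norm (g z) powr P) + ennreal (c * (1 - 1 / P))" for z
      using young_scaled[OF P c, of "norm (g z)"] P c
      by (subst ennreal_mult[symmetric], simp, simp, subst ennreal_plus[symmetric])
        (auto intro!: ennreal_leI simp del: ennreal_plus)
    then have "(\<integral>\<^sup>+z\<in>B. ennreal (norm (g z)) \<partial>\<mu>) \<le>
        (\<integral>\<^sup>+z. ennreal ?k * (ennreal (norm (g z) powr P) * indicator B z) +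
          ennreal (c * (1 - 1 / P)) * indicator B z \<partial>\<mu>)"
      by (intro nn_integral_mono) (auto simp: indicator_def)
    also have "\<dots> = ennreal ?k * I + ennreal (c * (1 - 1 / P)) * ennreal m"
      using m by (simp add: nn_integral_add nn_integral_cmult nn_integral_cmult_indicator I_def)
    also have "\<dots> \<le> ennreal ?k * ennreal (c powr P * m) + ennreal (c * (1 - 1 / P)) * ennreal m"
      by (intro add_right_mono mult_left_mono I) auto
    also have "\<dots> = ennreal (?k * (c powr P * m) + c * (1 - 1 / P) * m)"
      using P c m by (simp add: ennreal_mult[symmetric] ennreal_plus[symmetric] del: ennreal_plus)
    \<comment> \<open>The weights 1/P and 1 - 1/P add up to 1, so no constant is lost.\<close>
    also have "?k * (c powr P * m) + c * (1 - 1 / P) * m = c * m"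
      using P c by (simp add: powr_diff field_simps)
    finally show ?thesis .
  qed
qed

section \<open>Comparing infima of admissible constants\<close>

text \<open>Each implication has its own ratio \<open>L\<close>; the larger \<open>K\<close> allows
  all of them to be reported with one constant. If no constant satisfies \<open>P\<close>, the
  right-hand side is \<infinity> and the bound is trivial.\<close>

lemma inf_const_le:
  assumes "\<And>C. P C \<Longrightarrow> 0 \<le> C" and "\<And>C. P C \<Longrightarrow> Q (L * C)" and L: "0 < L" "L \<le> K"
  shows "inf_const Q \<le> ereal K * inf_const P"
proof -
  have K: "0 < K" using L by simp
  \<comment> \<open>With \<open>K\<close> moved to the left, it suffices to bound by each single
    \<open>C\<close>, and scaling need not be interchanged with the infimum.\<close>
  have "inf_const Q / ereal K \<le> inf_const P"
    unfolding inf_const_def[of P]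
  proof (rule INF_greatest)
    fix C assume "C \<in> {C. P C}"
    then have C: "0 \<le> C" "Q (L * C)"
      using assms by auto
    have "inf_const Q \<le> ereal (L * C)"
      unfolding inf_const_def using C by (intro INF_lower) auto
    also have "\<dots> \<le> ereal K * ereal C"
      using L C by (simp add: mult_right_mono)
    finally show "inf_const Q / ereal K \<le> ereal C"
      using K by (simp add: ereal_divide_le_pos)
  qed
  then show ?thesis
    using K by (simp add: ereal_divide_le_pos)
qed

section \<open>Radon measures and their support\<close>

locale radon =
  fixes \<mu> :: "'a::euclidean_space measure"
  assumes radon: "radon_measure \<mu>"
begin

lemma sets_eq [measurable_cong, simp]: "sets \<mu> = sets borel"
  using radon by (simp add: radon_measure_def)

lemma space_eq [simp]: "space \<mu> = UNIV"
  using sets_eq_imp_space_eq[OF sets_eq] by simp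

lemma emeasure_compact_finite: "compact K \<Longrightarrow> emeasure \<mu> K < \<infinity>"
  using radon by (simp add: radon_measure_def)

lemma emeasure_ball_finite: "emeasure \<mu> (ball x r) < \<infinity>"
proof -
  have "emeasure \<mu> (ball x r) \<le> emeasure \<mu> (cball x r)"
    by (intro emeasure_mono) auto
  then show ?thesis
    using emeasure_compact_finite[of "cball x r"] by (simp add: le_less_trans)
qed

text \<open>Exhaustion by balls about 0. Sigma-finiteness is what permits Fubini against Lebesgue
  measure.\<close>

sublocale sigma_finite_measure \<mu>
proof
  show "\<exists>A. countable A \<and> A \<subseteq> sets \<mu> \<and> \<Union>A = space \<mu> \<and> (\<forall>a\<in>A. emeasure \<mu> a \<noteq> \<infinity>)"
  proof (intro exI[of _ "range (\<lambda>k::nat. ball 0 (real k))"] conjI)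
    show "\<Union> (range (\<lambda>k::nat. ball (0::'a) (real k))) = space \<mu>"
      using reals_Archimedean2 by auto
  qed (use emeasure_ball_finite in \<open>auto simp: less_top\<close>)
qed

lemma emeasure_eq_measure: "emeasure \<mu> (ball x r) = ennreal (measure \<mu> (ball x r))"
  using emeasure_ball_finite[of x r] by (simp add: emeasure_eq_ennreal_measure)

lemma measure_ball_pos: "x \<in> msupport \<mu> \<Longrightarrow> 0 < r \<Longrightarrow> 0 < measure \<mu> (ball x r)"
  using emeasure_eq_measure[of x r] by (auto simp: msupport_def)

lemma null_ball_disjoint_msupport:
  assumes "emeasure \<mu> (ball x r) = 0"
  shows "ball x r \<inter> msupport \<mu> = {}"
proof (rule ccontr)
  assume "ball x r \<inter> msupport \<mu> \<noteq> {}"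
  then obtain y where y: "y \<in> ball x r" "y \<in> msupport \<mu>"
    by auto
  obtain e where e: "0 < e" "ball y e \<subseteq> ball x r"
    using openE[OF open_ball y(1)] by auto
  have "emeasure \<mu> (ball y e) \<le> emeasure \<mu> (ball x r)"
    using e by (intro emeasure_mono) auto
  with assms y e show False
    by (auto simp: msupport_def)
qed

lemma closed_msupport: "closed (msupport \<mu>)"
proof -
  have "open (- msupport \<mu>)"
  proof (subst open_contains_ball, intro ballI)
    fix x assume "x \<in> - msupport \<mu>"
    then obtain r where r: "0 < r" "emeasure \<mu> (ball x r) = 0"
      by (auto simp: msupport_def)
    then show "\<exists>r>0. ball x r \<subseteq> - msupport \<mu>"
      using null_ball_disjoint_msupport by blast
  qed
  then show ?thesis
    by (simp add: closed_def)
qed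

text \<open>Null balls cover the complement of the support, and by Lindelof's theorem countably many
  of them suffice.\<close>

lemma AE_msupport: "AE x in \<mu>. x \<in> msupport \<mu>"
proof -
  define \<B> where "\<B> = {ball x r |x r. emeasure \<mu> (ball x r) = 0}"
  have "\<And>S. S \<in> \<B> \<Longrightarrow> open S"
    by (auto simp: \<B>_def)
  then obtain \<C> where \<C>: "\<C> \<subseteq> \<B>" "countable \<C>" "\<Union>\<C> = \<Union>\<B>"
    using Lindelof[of \<B>] by metis
  have "(\<Union>C\<in>\<C>. C) \<in> null_sets \<mu>"
    using \<C> by (intro null_sets_UN') (auto simp: \<B>_def null_sets_def)
  moreover have "x \<in> \<Union>\<B>" if "x \<notin> msupport \<mu>" for x
    using that by (force simp: \<B>_def msupport_def)
  ultimately show ?thesis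
    using \<C>(3) by (intro AE_I'[of "\<Union>\<C>"]) auto
qed

section \<open>A vanishing criterion without doubling\<close>

text \<open>When the hypothesis is integrated over the centre \<open>x\<close>, Fubini weights each
  point z on the left by the volume of B(z,r) and on the right by that of B(z,cr). These volumes
  differ by the fixed factor c^d, with d the dimension, whatever \<mu> is; so r^d cancels and
  r^\<alpha> remains.\<close>

lemma AE_eq_0_of_ball_decay:
  fixes h :: "'a \<Rightarrow> ennreal"
  assumes [measurable]: "h \<in> borel_measurable borel" and \<alpha>: "0 < \<alpha>" and D: "0 \<le> D" and c: "0 < c"
    and decay: "\<And>x r. 0 < r \<Longrightarrow>
      (\<integral>\<^sup>+z\<in>ball x r. h z \<partial>\<mu>) \<le> ennreal (D * r powr \<alpha>) * emeasure \<mu> (ball x (c * r))"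
  shows "AE z in \<mu>. h z = 0"
proof -
  interpret P: pair_sigma_finite lborel \<mu> ..
  let ?V = "unit_ball_vol (real DIM('a))" and ?d = "DIM('a)"
  \<comment> \<open>Written as the indicator of an open set of pairs, the moving ball is jointly
    measurable in centre and point.\<close>
  have eq: "indicator (ball x r) z = (indicator {p. dist (fst p) (snd p) < r} (x, z) :: ennreal)"
    for x z :: 'a and r
    by (auto simp: indicator_def)
  have [measurable]: "{p :: 'a \<times> 'a. dist (fst p) (snd p) < r} \<in> sets (borel \<Otimes>\<^sub>M borel)" for r
    unfolding borel_prod by (intro borel_open open_Collect_less continuous_intros)
  have meas: "(\<lambda>x. \<integral>\<^sup>+z. g z * indicator (ball x r) z \<partial>\<mu>) \<in> borel_measurable lborel"
    if [measurable]: "g \<in> borel_measurable borel" for g :: "'a \<Rightarrow> ennreal" and r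
    unfolding eq by measurable
  have *: "(\<integral>\<^sup>+x. (\<integral>\<^sup>+z. g z * indicator (ball x r) z \<partial>\<mu>) \<partial>lborel) =
      (\<integral>\<^sup>+z. g z \<partial>\<mu>) * ennreal (?V * r ^ ?d)"
    if [measurable]: "g \<in> borel_measurable borel" and r: "0 \<le> r" for g :: "'a \<Rightarrow> ennreal" and r
  proof -
    have "(\<integral>\<^sup>+x. (\<integral>\<^sup>+z. g z * indicator (ball x r) z \<partial>\<mu>) \<partial>lborel) =
        (\<integral>\<^sup>+z. (\<integral>\<^sup>+x. g z * indicator (ball x r) z \<partial>lborel) \<partial>\<mu>)"
      unfolding eq by (rule P.Fubini'[symmetric]) measurable
    also have "\<dots> = (\<integral>\<^sup>+z. (\<integral>\<^sup>+x. g z * indicator (ball z r) x \<partial>lborel) \<partial>\<mu>)"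
      by (intro nn_integral_cong) (auto simp: indicator_def dist_commute)
    also have "\<dots> = (\<integral>\<^sup>+z. g z * ennreal (?V * r ^ ?d) \<partial>\<mu>)"
      using r by (simp add: nn_integral_cmult_indicator emeasure_ball)
    also have "\<dots> = (\<integral>\<^sup>+z. g z \<partial>\<mu>) * ennreal (?V * r ^ ?d)"
      by (rule nn_integral_multc) measurable
    finally show ?thesis .
  qed
  have zero: "(\<integral>\<^sup>+z. h z * indicator (ball 0 R) z \<partial>\<mu>) = 0" (is "?I = 0") if R: "0 < R" for R
  proof -
    \<comment> \<open>Restricting \<open>h\<close> to \<open>ball 0 R\<close> keeps the right-hand
      side finite: if \<open>r \<le> 1\<close> and \<open>ball x r\<close> meets
      \<open>ball 0 R\<close>, then \<open>ball x (c * r)\<close> lies in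
      \<open>ball 0 (R + (1 + c))\<close>. All other centres contribute 0 on the left.\<close>
    define M where "M = measure \<mu> (ball 0 (R + (1 + c)))"
    have bound: "?I \<le> ennreal (D * r powr \<alpha> * c ^ ?d * M)" if r: "0 < r" "r \<le> 1" for r
    proof -
      have "(\<integral>\<^sup>+z. h z * indicator (ball 0 R) z * indicator (ball x r) z \<partial>\<mu>) \<le>
          ennreal (D * r powr \<alpha>) *
            (\<integral>\<^sup>+z. indicator (ball 0 (R + (1 + c))) z * indicator (ball x (c * r)) z \<partial>\<mu>)" for x
      proof (cases "ball 0 R \<inter> ball x r = {}")
        case True
        then have zero: "(\<integral>\<^sup>+z. h z * indicator (ball 0 R) z * indicator (ball x r) z \<partial>\<mu>) = (\<integral>\<^sup>+z. 0 \<partial>\<mu>)"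
          by (intro nn_integral_cong) (auto simp: indicator_def)
        show ?thesis
          unfolding zero by simp
      next
        case False
        then obtain w where w: "norm w < R" "dist x w < r"
          by auto
        have sub: "ball x (c * r) \<subseteq> ball 0 (R + (1 + c))"
        proof
          fix z assume "z \<in> ball x (c * r)"
          then have "dist x z < c * r" by simp
          moreover have "norm z \<le> dist x z + dist x w + norm w"
            using dist_triangle[of z 0 x] dist_triangle[of x 0 w] by (simp add: dist_commute)
          moreover have "c * r \<le> c"
            using r c by (simp add: mult_left_le)
          ultimately show "z \<in> ball 0 (R + (1 + c))"
            using w r by auto
        qed
        have "(\<integral>\<^sup>+z. h z * indicator (ball 0 R) z * indicator (ball x r) z \<partial>\<mu>) \<le>
            (\<integral>\<^sup>+z\<in>ball x r. h z \<partial>\<mu>)"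
          by (intro nn_integral_mono) (auto simp: indicator_def)
        also have "\<dots> \<le> ennreal (D * r powr \<alpha>) * emeasure \<mu> (ball x (c * r))"
          by (rule decay[OF r(1)])
        also have "emeasure \<mu> (ball x (c * r)) = (\<integral>\<^sup>+z. indicator (ball x (c * r)) z \<partial>\<mu>)"
          by simp
        also have "\<dots> = (\<integral>\<^sup>+z. indicator (ball 0 (R + (1 + c))) z * indicator (ball x (c * r)) z \<partial>\<mu>)"
          using sub by (intro nn_integral_cong) (auto simp: indicator_def)
        finally show ?thesis .
      qed
      then have "(\<integral>\<^sup>+x. (\<integral>\<^sup>+z. h z * indicator (ball 0 R) z * indicator (ball x r) z \<partial>\<mu>) \<partial>lborel) \<le>
          (\<integral>\<^sup>+x. ennreal (D * r powr \<alpha>) *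
            (\<integral>\<^sup>+z. indicator (ball 0 (R + (1 + c))) z * indicator (ball x (c * r)) z \<partial>\<mu>) \<partial>lborel)"
        by (intro nn_integral_mono)
      also have "\<dots> = ennreal (D * r powr \<alpha>) * (\<integral>\<^sup>+x.
            (\<integral>\<^sup>+z. indicator (ball 0 (R + (1 + c))) z * indicator (ball x (c * r)) z \<partial>\<mu>) \<partial>lborel)"
        by (intro nn_integral_cmult meas borel_measurable_indicator) simp
      also have "(\<integral>\<^sup>+x. (\<integral>\<^sup>+z. indicator (ball 0 (R + (1 + c))) z * indicator (ball x (c * r)) z \<partial>\<mu>) \<partial>lborel) =
          emeasure \<mu> (ball 0 (R + (1 + c))) * ennreal (?V * (c * r) ^ ?d)"
        using r c by (subst *) (auto intro!: borel_measurable_indicator)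
      also have "(\<integral>\<^sup>+x. (\<integral>\<^sup>+z. h z * indicator (ball 0 R) z * indicator (ball x r) z \<partial>\<mu>) \<partial>lborel) =
          ?I * ennreal (?V * r ^ ?d)"
        using r by (intro * borel_measurable_times_ennreal borel_measurable_indicator) auto
      finally have "?I * ennreal (?V * r ^ ?d) \<le>
          ennreal (D * r powr \<alpha>) * (emeasure \<mu> (ball 0 (R + (1 + c))) * ennreal (?V * (c * r) ^ ?d))" .
      also have "\<dots> = ennreal (D * r powr \<alpha>) * ennreal M * ennreal (?V * (c * r) ^ ?d)"
        by (simp add: emeasure_eq_measure M_def mult.assoc)
      also have "\<dots> = ennreal (D * r powr \<alpha> * c ^ ?d * M) * ennreal (?V * r ^ ?d)"
        using D r c by (simp add: M_def ennreal_mult[symmetric] power_mult_distrib mult_ac)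
      finally show ?thesis
        using r ennreal_mult_le_mult_iff[of "ennreal (?V * r ^ ?d)" ?I "ennreal (D * r powr \<alpha> * c ^ ?d * M)"]
        by (simp add: mult.commute ennreal_eq_0_iff not_le)
    qed
    \<comment> \<open>Now r tends to 0; the limit of the bounds is 0 because
      \<open>0 powr \<alpha> = 0\<close>.\<close>
    have "((\<lambda>r. ennreal (D * r powr \<alpha> * c ^ ?d * M)) \<longlongrightarrow> ennreal (D * 0 powr \<alpha> * c ^ ?d * M)) (at_right 0)"
      using \<alpha> by (intro tendsto_ennrealI tendsto_intros tendsto_powr') (auto simp: eventually_at_filter)
    moreover have "eventually (\<lambda>r. ?I \<le> ennreal (D * r powr \<alpha> * c ^ ?d * M)) (at_right 0)"
      using eventually_at_right_real[OF zero_less_one] by eventually_elim (use bound in auto)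
    ultimately have "?I \<le> ennreal (D * 0 powr \<alpha> * c ^ ?d * M)"
      by (intro tendsto_lowerbound) auto
    then show ?thesis
      by simp
  qed
  \<comment> \<open>\<open>Suc k\<close> keeps the radius positive, as \<open>zero\<close>
    requires.\<close>
  have "AE z in \<mu>. h z * indicator (ball 0 (real (Suc k))) z = 0" for k
  proof -
    have "(\<lambda>z. h z * indicator (ball 0 (real (Suc k))) z) \<in> borel_measurable \<mu>"
      by (intro borel_measurable_times_ennreal borel_measurable_indicator) auto
    from nn_integral_0_iff_AE[OF this] zero[of "real (Suc k)"] show ?thesis
      by simp
  qed
  then have "AE z in \<mu>. \<forall>k. h z * indicator (ball 0 (real (Suc k))) z = 0"
    unfolding AE_all_countable by blast
  then show ?thesis
  proof eventually_elim
    case (elim z)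
    obtain k where "norm z < real k"
      using reals_Archimedean2 by blast
    then have "norm z < real (Suc k)" by simp
    with elim[rule_format, of k] show ?case
      by (simp add: indicator_def)
  qed
qed

section \<open>Local integrability and means over balls\<close>

lemma L1_loc_measurable: "f \<in> L1_loc \<mu> \<Longrightarrow> f \<in> borel_measurable \<mu>"
  by (simp add: L1_loc_def)

lemma set_integrable_ball_const: "set_integrable \<mu> (ball x r) (\<lambda>z. a :: 'k::{banach, second_countable_topology})"
  unfolding set_integrable_def using emeasure_ball_finite
  by (intro integrable_scaleR_left integrable_real_indicator) auto

lemma set_integrable_ball_diff:
  assumes "f \<in> L1_loc \<mu>"
  shows "set_integrable \<mu> (ball x r) (\<lambda>z. f z - a)"
proof (intro set_integral_diff set_integrable_ball_const)
  have "set_integrable \<mu> (cball x r) f"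
    using assms by (simp add: L1_loc_def)
  then show "set_integrable \<mu> (ball x r) f"
    by (rule set_integrable_subset) auto
qed

text \<open>Condition (I) uses the Bochner integral, while the estimates run in
  \<open>ennreal\<close>; local integrability makes the two agree.\<close>

lemma nn_set_integral_ball:
  assumes "f \<in> L1_loc \<mu>"
  shows "(\<integral>\<^sup>+z\<in>ball x r. ennreal (norm (f z - a)) \<partial>\<mu>) =
    ennreal (LINT z:ball x r|\<mu>. norm (f z - a))"
proof -
  have "set_integrable \<mu> (ball x r) (\<lambda>z. norm (f z - a))"
    using set_integrable_ball_diff[OF assms] by (rule set_integrable_norm)
  then have "(\<integral>\<^sup>+z. ennreal (indicator (ball x r) z *\<^sub>R norm (f z - a)) \<partial>\<mu>) =
      ennreal (\<integral>z. indicator (ball x r) z *\<^sub>R norm (f z - a) \<partial>\<mu>)"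
    unfolding set_integrable_def by (intro nn_integral_eq_integral) auto
  moreover have "(\<integral>\<^sup>+z. ennreal (indicator (ball x r) z *\<^sub>R norm (f z - a)) \<partial>\<mu>) =
      (\<integral>\<^sup>+z\<in>ball x r. ennreal (norm (f z - a)) \<partial>\<mu>)"
    by (intro nn_integral_cong) (auto simp: indicator_def)
  ultimately show ?thesis
    by (simp add: set_lebesgue_integral_def)
qed

text \<open>Subtracting \<open>a\<close> commutes with averaging because the ball has positive
  finite measure. It is applied with \<open>a\<close> a value of \<open>f\<close> and with
  \<open>a\<close> the mean over a larger ball.\<close>

lemma norm_mean_diff_le:
  fixes f :: "'a \<Rightarrow> 'k::{real_normed_field, euclidean_space}"
  assumes f: "f \<in> L1_loc \<mu>" and x: "x \<in> msupport \<mu>" "0 < r"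
    and le: "AE z in \<mu>. z \<in> ball x r \<longrightarrow> norm (f z - a) \<le> D"
  shows "norm (mean \<mu> f (ball x r) - a) \<le> D"
proof -
  define m where "m = measure \<mu> (ball x r)"
  have m: "0 < m"
    using measure_ball_pos[OF x] by (simp add: m_def)
  have const: "(LINT z:ball x r|\<mu>. b) = m *\<^sub>R b" for b :: "'b::{banach, second_countable_topology}"
    using emeasure_ball_finite[of x r] by (simp add: set_lebesgue_integral_def m_def less_top)
  have "set_integrable \<mu> (ball x r) f"
    using set_integrable_ball_diff[OF f, of x r 0] by simp
  then have "(LINT z:ball x r|\<mu>. f z - a) = (LINT z:ball x r|\<mu>. f z) - m *\<^sub>R a"
    by (simp add: set_integral_diff set_integrable_ball_const const)
  then have eq: "mean \<mu> f (ball x r) - a = (1 / m) *\<^sub>R (LINT z:ball x r|\<mu>. f z - a)"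
    using m by (simp add: mean_def m_def[symmetric] scaleR_diff_right)
  have "norm (LINT z:ball x r|\<mu>. f z - a) \<le> (LINT z:ball x r|\<mu>. norm (f z - a))"
    using set_integrable_ball_diff[OF f] by (rule set_integral_norm_bound)
  also have "\<dots> \<le> (LINT z:ball x r|\<mu>. D)"
    using le by (intro set_integral_mono_AE set_integrable_norm set_integrable_ball_diff f
      set_integrable_ball_const) auto
  also have "\<dots> = m * D"
    by (simp add: const)
  finally show ?thesis
    using m by (simp add: eq field_simps)
qed

section \<open>The implications between the three conditions\<close>

text \<open>The constant is unchanged: Jensen's inequality loses nothing, and replacing \<mu>(B) by
  \<mu>(2B) only weakens the estimate.\<close>

lemma admissible_III_imp_I:
  assumes f: "f \<in> L1_loc \<mu>" and p: "1 \<le> p" and III: "admissible_III p \<mu> \<alpha> f C"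
  shows "admissible_I \<mu> \<alpha> f C"
  unfolding admissible_I_def
proof (intro conjI exI[of _ "\<lambda>x r. mean \<mu> f (ball x r)"] ballI allI impI)
  show C: "0 \<le> C"
    using III by (simp add: admissible_III_def)
  fix x :: 'a and r :: real assume x: "x \<in> msupport \<mu>" and r: "0 < r"
  let ?m = "mean \<mu> f (ball x r)"
  note [measurable] = L1_loc_measurable[OF f]
  have "(\<integral>\<^sup>+z\<in>ball x r. ennreal (norm (f z - ?m)) \<partial>\<mu>) \<le> ennreal (C * r powr \<alpha> * measure \<mu> (ball x r))"
  proof (rule Lp_average_leD[OF _ emeasure_eq_measure measure_ball_pos[OF x r] _ p])
    show "Lp_average p \<mu> (ball x r) (\<lambda>z. f z - ?m) \<le> ennreal (C * r powr \<alpha>)"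
      using III x r by (simp add: admissible_III_def)
  qed (use C in auto)
  then have "(LINT z:ball x r|\<mu>. norm (f z - ?m)) \<le> C * r powr \<alpha> * measure \<mu> (ball x r)"
    using C unfolding nn_set_integral_ball[OF f] by (subst (asm) ennreal_le_iff) auto
  also have "\<dots> \<le> C * r powr \<alpha> * measure \<mu> (ball x (2 * r))"
  proof (intro mult_left_mono)
    have "emeasure \<mu> (ball x r) \<le> emeasure \<mu> (ball x (2 * r))"
      using r by (intro emeasure_mono) auto
    then show "measure \<mu> (ball x r) \<le> measure \<mu> (ball x (2 * r))"
      by (simp add: emeasure_eq_measure)
  qed (use C in auto)
  finally show "1 / measure \<mu> (ball x (2 * r)) * (LINT z:ball x r|\<mu>. norm (f z - ?m)) \<le> C * r powr \<alpha>"
    using measure_ball_pos[OF x, of "2 * r"] r by (simp add: field_simps)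
qed (use III in \<open>auto simp: admissible_III_def\<close>)

text \<open>The factor 4 comes from comparing means: two points of U are at distance at most 2s
  \<le> 4r, and 4^\<alpha> \<le> 4 since \<alpha> \<le> 1.\<close>

lemma admissible_II_imp_III:
  fixes f :: "'a \<Rightarrow> 'k::{real_normed_field, euclidean_space}"
  assumes f: "f \<in> L1_loc \<mu>" and p: "1 \<le> p" and \<alpha>: "0 < \<alpha>" "\<alpha> \<le> 1" and II: "admissible_II \<mu> \<alpha> f C"
  shows "admissible_III p \<mu> \<alpha> f (4 * C)"
proof -
  obtain N where C: "0 \<le> C" and N: "N \<in> null_sets \<mu>"
    and le: "\<And>x y. x \<in> msupport \<mu> - N \<Longrightarrow> y \<in> msupport \<mu> - N \<Longrightarrow> norm (f x - f y) \<le> C * dist x y powr \<alpha>"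
    using II by (auto simp: admissible_II_def)
  have AE: "AE z in \<mu>. z \<in> msupport \<mu> - N"
    using AE_msupport AE_not_in[OF N] by eventually_elim simp
  have ptwise: "norm (f z - mean \<mu> f (ball x r)) \<le> C * (2 * r) powr \<alpha>"
    if x: "x \<in> msupport \<mu>" "0 < r" and z: "z \<in> msupport \<mu> - N" "z \<in> ball x r" for x r z
  proof -
    have "AE w in \<mu>. w \<in> ball x r \<longrightarrow> norm (f w - f z) \<le> C * (2 * r) powr \<alpha>"
      using AE
    proof eventually_elim
      case (elim w)
      show ?case
      proof
        assume "w \<in> ball x r"
        then have "dist w z \<le> 2 * r"
          using z dist_triangle3[of w z x] by simp
        then have "C * dist w z powr \<alpha> \<le> C * (2 * r) powr \<alpha>"
          using C \<alpha> by (intro mult_left_mono powr_mono2) auto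
        with le[OF elim z(1)] show "norm (f w - f z) \<le> C * (2 * r) powr \<alpha>"
          by simp
      qed
    qed
    from norm_mean_diff_le[OF f x this] show ?thesis
      by (simp add: norm_minus_commute)
  qed
  have scale: "C * (k * r) powr \<alpha> \<le> 4 * C * r powr \<alpha>" if "0 < r" "1 \<le> k" "k \<le> 4" for k r :: real
  proof -
    have "k powr \<alpha> \<le> k powr 1"
      using \<alpha> that by (intro powr_mono) auto
    then have "k powr \<alpha> * (C * r powr \<alpha>) \<le> 4 * (C * r powr \<alpha>)"
      using that C by (intro mult_right_mono) auto
    then show ?thesis
      using that by (simp add: powr_mult mult_ac)
  qed
  note [measurable] = L1_loc_measurable[OF f]
  show ?thesis
    unfolding admissible_III_def
  proof (intro conjI ballI allI impI)
    fix x :: 'a and r :: real assume x: "x \<in> msupport \<mu>" "0 < r"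
    show "Lp_average p \<mu> (ball x r) (\<lambda>z. f z - mean \<mu> f (ball x r)) \<le> ennreal (4 * C * r powr \<alpha>)"
    proof (rule Lp_average_leI[OF _ emeasure_eq_measure measure_ball_pos[OF x] _ p])
      show "AE z in \<mu>. z \<in> ball x r \<longrightarrow> norm (f z - mean \<mu> f (ball x r)) \<le> 4 * C * r powr \<alpha>"
        using AE
      proof eventually_elim
        case (elim z)
        show ?case
          using ptwise[OF x elim] scale[OF x(2), of 2] by auto
      qed
    qed (use C in auto)
    fix y :: 'a and s :: real
    assume y: "y \<in> msupport \<mu>" "0 < s" and sub: "ball x r \<subseteq> ball y s \<and> s \<le> 2 * r"
    show "norm (mean \<mu> f (ball x r) - mean \<mu> f (ball y s)) \<le> 4 * C * r powr \<alpha>"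
    proof (rule norm_mean_diff_le[OF f x])
      have "C * (2 * s) powr \<alpha> \<le> C * (4 * r) powr \<alpha>"
        using sub y C \<alpha> by (intro mult_left_mono powr_mono2) auto
      also have "\<dots> \<le> 4 * C * r powr \<alpha>"
        using x by (intro scale) auto
      finally have bound: "C * (2 * s) powr \<alpha> \<le> 4 * C * r powr \<alpha>" .
      \<comment> \<open>Almost every point of the small ball is also a point of the large one, where
        \<open>ptwise\<close> bounds its distance to the large mean.\<close>
      show "AE z in \<mu>. z \<in> ball x r \<longrightarrow> norm (f z - mean \<mu> f (ball y s)) \<le> 4 * C * r powr \<alpha>"
        using AE
      proof eventually_elim
        case (elim z)
        show ?case
        proof
          assume "z \<in> ball x r"
          with sub have "z \<in> ball y s" by blast
          then have "norm (f z - mean \<mu> f (ball y s)) \<le> C * (2 * s) powr \<alpha>"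
            by (rule ptwise[OF y elim])
          then show "norm (f z - mean \<mu> f (ball y s)) \<le> 4 * C * r powr \<alpha>"
            using bound by (rule order_trans)
        qed
      qed
    qed
  qed (use C in auto)
qed

lemma admissible_I_imp_II:
  fixes f :: "'a \<Rightarrow> 'k::{real_normed_field, euclidean_space}"
  assumes f: "f \<in> L1_loc \<mu>" and \<alpha>: "0 < \<alpha>" "\<alpha> \<le> 1" and I: "admissible_I \<mu> \<alpha> f C"
  shows "admissible_II \<mu> \<alpha> f ((3 / (2 powr \<alpha> - 1) + 1) * C)"
proof -
  define A where "A = C / (2 powr \<alpha> - 1)"
  have two: "1 < 2 powr \<alpha>" "2 powr \<alpha> \<le> 2"
    using \<alpha> powr_mono[of \<alpha> 1 2] by auto
  have double: "b * (2 * r) powr \<alpha> \<le> 2 * b * r powr \<alpha>" if "0 \<le> b" "0 < r" for b r :: real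
    using mult_right_mono[OF two(2), of "b * r powr \<alpha>"] that by (simp add: powr_mult mult_ac)
  obtain F where C: "0 \<le> C"
    and osc: "\<And>x r. x \<in> msupport \<mu> \<Longrightarrow> 0 < r \<Longrightarrow>
      1 / measure \<mu> (ball x (2 * r)) * (LINT z:ball x r|\<mu>. norm (f z - F x r)) \<le> C * r powr \<alpha>"
    and step: "\<And>x r y s. x \<in> msupport \<mu> \<Longrightarrow> 0 < r \<Longrightarrow> y \<in> msupport \<mu> \<Longrightarrow> 0 < s \<Longrightarrow>
      ball x r \<subseteq> ball y s \<Longrightarrow> s \<le> 2 * r \<Longrightarrow> norm (F x r - F y s) \<le> C * r powr \<alpha>"
    using I unfolding admissible_I_def by blast
  have A: "0 \<le> A"
    using two C by (simp add: A_def)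
  have "\<exists>g. \<forall>r>0. norm (F x r - g) \<le> A * r powr \<alpha>" if "x \<in> msupport \<mu>" for x
    unfolding A_def using that by (intro dyadic_chain_limit \<alpha> C step) auto
  then obtain g where g: "\<And>x r. x \<in> msupport \<mu> \<Longrightarrow> 0 < r \<Longrightarrow> norm (F x r - g x) \<le> A * r powr \<alpha>"
    by metis
  \<comment> \<open>With r = |x - y|, going from g(x) to F(x,r) costs A, from F(x,r) to F(y,2r)
    costs C, and from F(y,2r) to g(y) costs 2^\<alpha> A \<le> 2A, each times r^\<alpha>.\<close>
  define H where "H = 3 * A + C"
  have H: "0 \<le> H"
    using A C by (simp add: H_def)
  have hoelder: "norm (g x - g y) \<le> H * dist x y powr \<alpha>" if x: "x \<in> msupport \<mu>" and y: "y \<in> msupport \<mu>" for x y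
  proof (cases "x = y")
    case False
    define r where "r = dist x y"
    have r: "0 < r" using False by (simp add: r_def)
    have "ball x r \<subseteq> ball y (2 * r)"
    proof
      fix z assume "z \<in> ball x r"
      then show "z \<in> ball y (2 * r)"
        using dist_triangle[of y z x] by (simp add: r_def dist_commute)
    qed
    then have "norm (F x r - F y (2 * r)) \<le> C * r powr \<alpha>"
      using r by (intro step x y) auto
    moreover have "norm (F x r - g x) \<le> A * r powr \<alpha>"
      using g x r by simp
    moreover have "norm (F y (2 * r) - g y) \<le> A * (2 * r) powr \<alpha>"
      using g y r by simp
    moreover have "A * (2 * r) powr \<alpha> \<le> 2 * A * r powr \<alpha>"
      using A r by (rule double)
    moreover have "norm (g x - g y) \<le> norm (F x r - g x) + norm (F x r - F y (2 * r)) + norm (F y (2 * r) - g y)"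
      using norm_triangle_ineq[of "g x - F x r" "F x r - F y (2 * r)"]
        norm_triangle_ineq[of "g x - F y (2 * r)" "F y (2 * r) - g y"]
      by (simp add: norm_minus_commute)
    ultimately show ?thesis
      unfolding r_def[symmetric] H_def by (simp add: algebra_simps)
  qed simp

  \<comment> \<open>Continuity on the closed support supplies measurability of \<open>g\<close>
    there.\<close>
  have cont: "continuous_on (msupport \<mu>) g"
    unfolding continuous_on_def
  proof
    fix x assume x: "x \<in> msupport \<mu>"
    have "((\<lambda>y. H * dist y x powr \<alpha>) \<longlongrightarrow> H * dist x x powr \<alpha>) (at x within msupport \<mu>)"
      using \<alpha> by (intro tendsto_intros tendsto_powr') auto
    then have "((\<lambda>y. H * dist y x powr \<alpha>) \<longlongrightarrow> 0) (at x within msupport \<mu>)"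
      by simp
    then have "((\<lambda>y. g y - g x) \<longlongrightarrow> 0) (at x within msupport \<mu>)"
    proof (rule Lim_null_comparison[rotated])
      show "\<forall>\<^sub>F y in at x within msupport \<mu>. norm (g y - g x) \<le> H * dist y x powr \<alpha>"
        using x by (auto simp: eventually_at_filter hoelder)
    qed
    then show "(g \<longlongrightarrow> g x) (at x within msupport \<mu>)"
      by (simp add: LIM_zero_iff)
  qed
  have [measurable]: "f \<in> borel_measurable borel"
    using L1_loc_measurable[OF f] by simp
  have [measurable]: "msupport \<mu> \<in> sets borel"
    using closed_msupport by simp
  \<comment> \<open>Nothing is known about \<open>g\<close> off the support, so both functions are
    cut off there. This also makes \<open>h\<close> vanish on balls that miss the support.\<close>
  define h where "h = (\<lambda>z. ennreal (norm (indicator (msupport \<mu>) z *\<^sub>R f z - indicator (msupport \<mu>) z *\<^sub>R g z)))"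
  have [measurable]: "(\<lambda>z. indicator (msupport \<mu>) z *\<^sub>R g z) \<in> borel_measurable borel"
    using cont by (intro borel_measurable_continuous_on_indicator) auto
  have [measurable]: "h \<in> borel_measurable borel"
    unfolding h_def by measurable
  \<comment> \<open>On B(x,r), C bounds the mean oscillation of f about F(x,r), A the gap from
    F(x,r) to g(x), and H the variation of g.\<close>
  define D where "D = C + A + H"
  have D: "0 \<le> D"
    using A C H by (simp add: D_def)
  have centred: "(\<integral>\<^sup>+z\<in>ball x r. h z \<partial>\<mu>) \<le> ennreal (D * r powr \<alpha>) * emeasure \<mu> (ball x (2 * r))"
    if x: "x \<in> msupport \<mu>" and r: "0 < r" for x r
  proof -
    have "h z \<le> ennreal (norm (f z - F x r)) + ennreal ((A + H) * r powr \<alpha>)" if z: "z \<in> ball x r" for z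
    proof (cases "z \<in> msupport \<mu>")
      case True
      have "H * dist x z powr \<alpha> \<le> H * r powr \<alpha>"
        using z H \<alpha> by (intro mult_left_mono powr_mono2) auto
      then have "norm (f z - g z) \<le> norm (f z - F x r) + (A + H) * r powr \<alpha>"
        using g[OF x r] hoelder[OF x True] norm_triangle_ineq[of "f z - F x r" "F x r - g x"]
          norm_triangle_ineq[of "f z - g x" "g x - g z"]
        by (simp add: algebra_simps)
      then show ?thesis
        using True A H by (simp add: h_def ennreal_plus[symmetric] ennreal_leI del: ennreal_plus)
    qed (simp add: h_def)
    then have "(\<integral>\<^sup>+z\<in>ball x r. h z \<partial>\<mu>) \<le>
        (\<integral>\<^sup>+z. ennreal (norm (f z - F x r)) * indicator (ball x r) z +
          ennreal ((A + H) * r powr \<alpha>) * indicator (ball x r) z \<partial>\<mu>)"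
      by (intro nn_integral_mono) (auto simp: indicator_def)
    also have "\<dots> = ennreal (LINT z:ball x r|\<mu>. norm (f z - F x r)) +
        ennreal ((A + H) * r powr \<alpha>) * emeasure \<mu> (ball x r)"
      unfolding nn_set_integral_ball[OF f, symmetric]
      by (subst nn_integral_add; (intro borel_measurable_times_ennreal borel_measurable_indicator)?;
          simp add: nn_integral_cmult_indicator)
    also have "\<dots> \<le> ennreal (C * r powr \<alpha>) * emeasure \<mu> (ball x (2 * r)) +
        ennreal ((A + H) * r powr \<alpha>) * emeasure \<mu> (ball x (2 * r))"
    proof (intro add_mono mult_left_mono)
      have "(LINT z:ball x r|\<mu>. norm (f z - F x r)) \<le> C * r powr \<alpha> * measure \<mu> (ball x (2 * r))"
        using osc[OF x r] measure_ball_pos[OF x, of "2 * r"] r by (simp add: field_simps)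
      then show "ennreal (LINT z:ball x r|\<mu>. norm (f z - F x r)) \<le>
          ennreal (C * r powr \<alpha>) * emeasure \<mu> (ball x (2 * r))"
        using C by (simp add: emeasure_eq_measure ennreal_mult[symmetric] ennreal_leI)
      show "emeasure \<mu> (ball x r) \<le> emeasure \<mu> (ball x (2 * r))"
        using r by (intro emeasure_mono) auto
    qed auto
    also have "\<dots> = ennreal (D * r powr \<alpha>) * emeasure \<mu> (ball x (2 * r))"
      using C A H by (simp add: D_def distrib_right[symmetric] ennreal_plus[symmetric] add.assoc del: ennreal_plus)
    finally show ?thesis .
  qed
  have "AE z in \<mu>. h z = 0"
  \<comment> \<open>The criterion needs all centres, \<open>centred\<close> only those in the
    support. If B(x,r) meets the support at y, then B(x,r) lies in B(y,2r) and B(y,4r) in B(x,5r),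
    which gives c = 5; 2^\<alpha> \<le> 2 gives 2D.\<close>
  proof (rule AE_eq_0_of_ball_decay[where D = "2 * D" and c = 5])
    fix x :: 'a and r :: real assume r: "0 < r"
    show "(\<integral>\<^sup>+z\<in>ball x r. h z \<partial>\<mu>) \<le> ennreal (2 * D * r powr \<alpha>) * emeasure \<mu> (ball x (5 * r))"
    proof (cases "ball x r \<inter> msupport \<mu> = {}")
      case True
      then have zero: "(\<integral>\<^sup>+z\<in>ball x r. h z \<partial>\<mu>) = (\<integral>\<^sup>+z. 0 \<partial>\<mu>)"
        by (intro nn_integral_cong) (auto simp: indicator_def h_def)
      show ?thesis
        unfolding zero by simp
    next
      case False
      then obtain y where y: "dist x y < r" "y \<in> msupport \<mu>"
        by auto
      have "(\<integral>\<^sup>+z\<in>ball x r. h z \<partial>\<mu>) \<le> (\<integral>\<^sup>+z\<in>ball y (2 * r). h z \<partial>\<mu>)"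
      proof (intro nn_integral_mono mult_left_mono)
        have "ball x r \<subseteq> ball y (2 * r)"
        proof
          fix z assume "z \<in> ball x r"
          then show "z \<in> ball y (2 * r)"
            using y dist_triangle3[of y z x] by simp
        qed
        then show "(indicator (ball x r) z :: ennreal) \<le> indicator (ball y (2 * r)) z" for z
          by (auto simp: indicator_def)
      qed auto
      also have "\<dots> \<le> ennreal (D * (2 * r) powr \<alpha>) * emeasure \<mu> (ball y (2 * (2 * r)))"
        using r y by (intro centred) auto
      also have "\<dots> \<le> ennreal (2 * D * r powr \<alpha>) * emeasure \<mu> (ball x (5 * r))"
      proof (rule mult_mono)
        show "ennreal (D * (2 * r) powr \<alpha>) \<le> ennreal (2 * D * r powr \<alpha>)"
          using D r by (intro ennreal_leI double)
        have "ball y (2 * (2 * r)) \<subseteq> ball x (5 * r)"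
        proof
          fix z assume "z \<in> ball y (2 * (2 * r))"
          then show "z \<in> ball x (5 * r)"
            using y dist_triangle[of x z y] by simp
        qed
        then show "emeasure \<mu> (ball y (2 * (2 * r))) \<le> emeasure \<mu> (ball x (5 * r))"
          by (intro emeasure_mono) auto
      qed auto
      finally show ?thesis .
    qed
  qed (use \<alpha> D in auto)
  then have "AE z in \<mu>. z \<in> msupport \<mu> \<longrightarrow> f z = g z"
    by eventually_elim (auto simp: h_def)
  then obtain N where N: "N \<in> null_sets \<mu>" "\<And>z. z \<in> msupport \<mu> - N \<Longrightarrow> f z = g z"
    by (auto elim!: AE_E3)
  have "(3 / (2 powr \<alpha> - 1) + 1) * C = H"
    by (simp add: H_def A_def algebra_simps)
  then show ?thesis
    unfolding admissible_II_def using N H hoelder by (auto intro!: bexI[OF _ N(1)])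
qed

end

section \<open>Equivalence and a common constant\<close>

theorem theorem2p3:
  fixes \<mu> :: "'a::euclidean_space measure" and n \<alpha> :: real and p :: ennreal
  assumes "radon_measure \<mu>" and "n_dimensional n \<mu>"
    and "0 < n" and "n \<le> real DIM('a)"
    and "0 < \<alpha>" and "\<alpha> \<le> 1"
    and "1 \<le> p"
  shows "(\<forall>f \<in> (L1_loc \<mu> :: ('a \<Rightarrow> 'k::{real_normed_field, euclidean_space}) set).
            ((\<exists>C. admissible_I \<mu> \<alpha> f C) \<longleftrightarrow> (\<exists>C. admissible_II \<mu> \<alpha> f C)) \<and>
            ((\<exists>C. admissible_II \<mu> \<alpha> f C) \<longleftrightarrow> (\<exists>C. admissible_III p \<mu> \<alpha> f C))) \<and>
         (\<exists>K::real. 0 < K \<and>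
           (\<forall>f \<in> (L1_loc \<mu> :: ('a \<Rightarrow> 'k) set).
             let Q = {inf_const (admissible_I \<mu> \<alpha> f),
                      inf_const (admissible_II \<mu> \<alpha> f),
                      inf_const (admissible_III p \<mu> \<alpha> f)}
             in \<forall>a\<in>Q. \<forall>b\<in>Q. a \<le> ereal K * b))"
proof -
  interpret radon \<mu>
    by standard fact
  note \<alpha> = \<open>0 < \<alpha>\<close> \<open>\<alpha> \<le> 1\<close>
  define L where "L = 3 / (2 powr \<alpha> - 1) + 1"
  have L: "1 \<le> L"
    using \<alpha> ge_one_powr_ge_zero[of 2 \<alpha>] by (simp add: L_def)
  have I_II: "admissible_II \<mu> \<alpha> f (L * C)"
    if "f \<in> L1_loc \<mu>" "admissible_I \<mu> \<alpha> f C" for f :: "'a \<Rightarrow> 'k" and C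
    unfolding L_def using admissible_I_imp_II[OF that(1) \<alpha> that(2)] .
  note II_III = admissible_II_imp_III[OF _ \<open>1 \<le> p\<close> \<alpha>]
  note III_I = admissible_III_imp_I[OF _ \<open>1 \<le> p\<close>]
  have nonneg: "admissible_I \<mu> \<alpha> f C \<Longrightarrow> 0 \<le> C" "admissible_II \<mu> \<alpha> f C \<Longrightarrow> 0 \<le> C"
    "admissible_III p \<mu> \<alpha> f C \<Longrightarrow> 0 \<le> C" for f :: "'a \<Rightarrow> 'k" and C
    by (auto simp: admissible_I_def admissible_II_def admissible_III_def)
  \<comment> \<open>The costliest route is from (I) through (II) to (III), with factor L and then 4.
    The other pairs, including a = b, have ratio 1, 4 or L, all at most 4L because
    \<open>1 \<le> L\<close>.\<close>
  have "a \<le> ereal (4 * L) * b"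
    if f: "f \<in> L1_loc \<mu>"
      and ab: "a \<in> {inf_const (admissible_I \<mu> \<alpha> f), inf_const (admissible_II \<mu> \<alpha> f), inf_const (admissible_III p \<mu> \<alpha> f)}"
        "b \<in> {inf_const (admissible_I \<mu> \<alpha> f), inf_const (admissible_II \<mu> \<alpha> f), inf_const (admissible_III p \<mu> \<alpha> f)}"
    for f :: "'a \<Rightarrow> 'k" and a b
  proof -
    have self: "inf_const P \<le> ereal (4 * L) * inf_const P" if "\<And>C. P C \<Longrightarrow> 0 \<le> C" for P
      using L by (intro inf_const_le[of _ _ 1] that) auto
    have "inf_const (admissible_II \<mu> \<alpha> f) \<le> ereal (4 * L) * inf_const (admissible_I \<mu> \<alpha> f)"
      using L I_II[OF f] by (intro inf_const_le[of _ _ L] nonneg(1)) auto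
    moreover have "inf_const (admissible_III p \<mu> \<alpha> f) \<le> ereal (4 * L) * inf_const (admissible_I \<mu> \<alpha> f)"
      using L II_III[OF f I_II[OF f]] by (intro inf_const_le[of _ _ "4 * L"] nonneg(1)) (auto simp: mult.assoc)
    moreover have "inf_const (admissible_III p \<mu> \<alpha> f) \<le> ereal (4 * L) * inf_const (admissible_II \<mu> \<alpha> f)"
      using L II_III[OF f] by (intro inf_const_le[of _ _ 4] nonneg(2)) auto
    moreover have "inf_const (admissible_I \<mu> \<alpha> f) \<le> ereal (4 * L) * inf_const (admissible_II \<mu> \<alpha> f)"
      using L III_I[OF f II_III[OF f]] by (intro inf_const_le[of _ _ 4] nonneg(2)) auto
    moreover have "inf_const (admissible_I \<mu> \<alpha> f) \<le> ereal (4 * L) * inf_const (admissible_III p \<mu> \<alpha> f)"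
      using L III_I[OF f] by (intro inf_const_le[of _ _ 1] nonneg(3)) auto
    moreover have "inf_const (admissible_II \<mu> \<alpha> f) \<le> ereal (4 * L) * inf_const (admissible_III p \<mu> \<alpha> f)"
      using L I_II[OF f III_I[OF f]] by (intro inf_const_le[of _ _ L] nonneg(3)) auto
    moreover note self[of "admissible_I \<mu> \<alpha> f", OF nonneg(1)]
      self[of "admissible_II \<mu> \<alpha> f", OF nonneg(2)] self[of "admissible_III p \<mu> \<alpha> f", OF nonneg(3)]
    ultimately show ?thesis
      using ab by auto
  qed
  moreover have "0 < 4 * L"
    using L by simp
  moreover have "(\<exists>C. admissible_I \<mu> \<alpha> f C) \<longleftrightarrow> (\<exists>C. admissible_II \<mu> \<alpha> f C)"
    "(\<exists>C. admissible_II \<mu> \<alpha> f C) \<longleftrightarrow> (\<exists>C. admissible_III p \<mu> \<alpha> f C)"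
    if f: "f \<in> L1_loc \<mu>" for f :: "'a \<Rightarrow> 'k"
    using I_II[OF f] II_III[OF f] III_I[OF f] by blast+
  ultimately show ?thesis
    unfolding Let_def by (intro conjI ballI exI[of _ "4 * L"]) simp_all
qed

end
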